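(* Let $\alpha>0$ and consider the linear ODE system $\dot{\bm u}=\bm A\bm u$ with $$\bm A=\begin{bmatrix}0&1\\-\alpha&-\alpha-1\end{bmatrix}.$$ The maximum stable time step of the partitioned SDC1 scheme for this system, treated as two scalar subsystems, is $$\Delta t_{\max}=\frac{\alpha+1+\sqrt{(\alpha+1)^2+4\alpha}}{\alpha}.$$
   Context: SDC1 is the first-order partitioned spectral deferred correction scheme with weak Gauss–Seidel coupling predictor. For a $2\times2$ system $\dot{\bm u}=\bm A\bm u$ with entries $a^{ij}$, one step of size $\Delta t>0$ from $(u^1_n,u^2_n)$ to $(u^1_{n+1},u^2_{n+1})$ is $$u^1_{n+1}=u^1_n+\Delta t\,(a^{11}u^1_{n+1}+a^{12}u^2_n),\qquad u^2_{n+1}=u^2_n+\Delta t\,(a^{21}u^1_{n+1}+a^{22}u^2_{n+1}).$$ For the matrix in the claim this is $\bm u_{n+1}=\bm C\bm u_n$ with update matrix $$\bm C=\begin{bmatrix}1&\Delta t\\-\frac{\alpha\Delta t}{1+\Delta t(\alpha+1)}&\frac{1-\alpha\Delta t^2}{1+\Delta t(\alpha+1)}\end{bmatrix}.$$ The scheme is stable for a given $\Delta t$ if the spectral radius satisfies $\rho(\bm C)<1$. The maximum stable time step is the number $\Delta t_{\max}$ such that the scheme is stable for every $0<\Delta t<\Delta t_{\max}$ and not stable for every $\Delta t>\Delta t_{\max}$. *)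

theory Defs
  imports "Jordan_Normal_Form.Spectral_Radius"
begin

text \<open>Matrix and vector indices start at 0 here, so that the entry usually written
  \<open>a\<^sup>1\<^sup>2\<close> is \<open>A $$ (0, 1)\<close>.\<close>

text \<open>One step from \<open>u\<close> to \<open>v\<close>. The predictor is weak Gauss--Seidel: the first subsystem
  sees the old value of the second one, the second subsystem the new value of the first one, and
  each subsystem is implicit in its own unknown.\<close>

definition sdc1_step :: "real mat \<Rightarrow> real \<Rightarrow> real vec \<Rightarrow> real vec \<Rightarrow> bool" where
  "sdc1_step A dt u v \<longleftrightarrow>
     v $ 0 = u $ 0 + dt * (A $$ (0, 0) * v $ 0 + A $$ (0, 1) * u $ 1) \<and>
     v $ 1 = u $ 1 + dt * (A $$ (1, 0) * v $ 0 + A $$ (1, 1) * v $ 1)"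

text \<open>The step equations are implicit, so the update matrix is described by a relation: it exists
  only if they determine the new value uniquely, and it is then unique (see below).\<close>

definition sdc1_update_matrix :: "real mat \<Rightarrow> real \<Rightarrow> real mat \<Rightarrow> bool" where
  "sdc1_update_matrix A dt C \<longleftrightarrow> C \<in> carrier_mat 2 2 \<and>
     (\<forall>u \<in> carrier_vec 2. \<forall>v \<in> carrier_vec 2. sdc1_step A dt u v \<longleftrightarrow> v = C *\<^sub>v u)"

definition sdc1_stable :: "real mat \<Rightarrow> real \<Rightarrow> bool" where
  "sdc1_stable A dt \<longleftrightarrow>
     (\<exists>C. sdc1_update_matrix A dt C \<and> spectral_radius (map_mat complex_of_real C) < 1)"

definition sdc1_max_stable_step :: "real mat \<Rightarrow> real \<Rightarrow> bool" where
  "sdc1_max_stable_step A dtmax \<longleftrightarrow> 0 < dtmax \<and>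
     (\<forall>dt. 0 < dt \<and> dt < dtmax \<longrightarrow> sdc1_stable A dt) \<and>
     (\<forall>dt. dt > dtmax \<longrightarrow> \<not> sdc1_stable A dt)"

definition ode_matrix :: "real \<Rightarrow> real mat" where
  "ode_matrix \<alpha> = mat_of_rows_list 2 [[0, 1], [- \<alpha>, - \<alpha> - 1]]"

lemma sdc1_update_matrix_unique:
  assumes "sdc1_update_matrix A dt C" "sdc1_update_matrix A dt D"
  shows "C = D"
proof -
  have C: "C \<in> carrier_mat 2 2" and D: "D \<in> carrier_mat 2 2"
    using assms by (auto simp: sdc1_update_matrix_def)
  have eq: "C *\<^sub>v u = D *\<^sub>v u" if u: "u \<in> carrier_vec 2" for u
  proof -
    have "C *\<^sub>v u \<in> carrier_vec 2" using C u by simp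
    then show ?thesis
      using assms u unfolding sdc1_update_matrix_def by blast
  qed
  show ?thesis
  proof (rule eq_matI)
    fix i j assume ij: "i < dim_row D" "j < dim_col D"
    have "(C *\<^sub>v unit_vec 2 j) $ i = (D *\<^sub>v unit_vec 2 j) $ i"
      by (simp add: eq)
    then show "C $$ (i, j) = D $$ (i, j)"
      using C D ij by simp
  qed (use C D in auto)
qed

lemma sdc1_max_stable_step_unique:
  assumes "sdc1_max_stable_step A s" "sdc1_max_stable_step A t"
  shows "s = t"
proof -
  have False if h: "sdc1_max_stable_step A x" "sdc1_max_stable_step A y" "x < y" for x y
  proof -
    obtain z where "x < z" "z < y" using dense h(3) by blast
    then show False using h unfolding sdc1_max_stable_step_def by (meson less_trans)
  qed
  then show ?thesis using assms by (meson linorder_neqE)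
qed

lemma sdc1_update_matrix_ode_matrix:
  assumes "\<alpha> > 0" "dt > 0"
  shows "sdc1_update_matrix (ode_matrix \<alpha>) dt
     (mat_of_rows_list 2
        [[1, dt],
         [- (\<alpha> * dt / (1 + dt * (\<alpha> + 1))), (1 - \<alpha> * dt^2) / (1 + dt * (\<alpha> + 1))]])"
    (is "sdc1_update_matrix _ _ ?C")
proof -
  have "dt * (\<alpha> + 1) > 0" using assms by simp
  then have d: "1 + dt * (\<alpha> + 1) \<noteq> 0" by linarith
  have C: "?C \<in> carrier_mat 2 2" by (rule carrier_matI) (simp_all add: mat_of_rows_list_def)
  have "sdc1_step (ode_matrix \<alpha>) dt u v \<longleftrightarrow> v = ?C *\<^sub>v u"
    if u: "u \<in> carrier_vec 2" and v: "v \<in> carrier_vec 2" for u v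
  proof -
    have dims: "dim_vec u = 2" "dim_vec v = 2" using u v by auto
    have r0: "(?C *\<^sub>v u) $ 0 = u $ 0 + dt * u $ 1"
      using dims by (simp add: mat_of_rows_list_def scalar_prod_def numeral_2_eq_2)
    have r1: "(?C *\<^sub>v u) $ 1 =
        (- (\<alpha> * dt) * u $ 0 + (1 - \<alpha> * dt^2) * u $ 1) / (1 + dt * (\<alpha> + 1))"
      using dims by (simp add: mat_of_rows_list_def scalar_prod_def numeral_2_eq_2
          diff_divide_distrib left_diff_distrib)
    have "v = ?C *\<^sub>v u \<longleftrightarrow> v $ 0 = (?C *\<^sub>v u) $ 0 \<and> v $ 1 = (?C *\<^sub>v u) $ 1"
    proof
      assume *: "v $ 0 = (?C *\<^sub>v u) $ 0 \<and> v $ 1 = (?C *\<^sub>v u) $ 1"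
      show "v = ?C *\<^sub>v u"
      proof (rule eq_vecI)
        fix i assume "i < dim_vec (?C *\<^sub>v u)"
        then have "i = 0 \<or> i = 1" using C by auto
        then show "v $ i = (?C *\<^sub>v u) $ i" using * by blast
      qed (use C dims in auto)
    qed blast
    also have "\<dots> \<longleftrightarrow> v $ 0 = u $ 0 + dt * u $ 1 \<and>
        v $ 1 * (1 + dt * (\<alpha> + 1)) = - (\<alpha> * dt) * u $ 0 + (1 - \<alpha> * dt^2) * u $ 1"
      unfolding r0 r1 by (simp only: nonzero_eq_divide_eq[OF d])
    also have "\<dots> \<longleftrightarrow> sdc1_step (ode_matrix \<alpha>) dt u v"
    proof -
      have "v $ 1 * (1 + dt * (\<alpha> + 1)) = - (\<alpha> * dt) * u $ 0 + (1 - \<alpha> * dt^2) * u $ 1 \<longleftrightarrow>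
          v $ 1 = u $ 1 + dt * (- \<alpha> * v $ 0 + (- \<alpha> - 1) * v $ 1)"
        if v0: "v $ 0 = u $ 0 + dt * u $ 1"
      proof -
        have "v $ 1 * (1 + dt * (\<alpha> + 1)) - (- (\<alpha> * dt) * u $ 0 + (1 - \<alpha> * dt^2) * u $ 1) =
            v $ 1 - (u $ 1 + dt * (- \<alpha> * v $ 0 + (- \<alpha> - 1) * v $ 1))"
          unfolding v0 by (simp add: algebra_simps power2_eq_square)
        then show ?thesis by (metis eq_iff_diff_eq_0)
      qed
      then show ?thesis
        by (auto simp: sdc1_step_def ode_matrix_def mat_of_rows_list_def)
    qed
    finally show ?thesis ..
  qed
  with C show ?thesis unfolding sdc1_update_matrix_def by blast
qed

end

theory Submission
  imports Defs
begin

text \<open>The update matrix has determinant \<open>D = 1 / (1 + \<Delta>t (\<alpha> + 1)) \<in> (0, 1)\<close> and trace \<open>T\<close> with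
  \<open>1 - T + D > 0\<close> for every positive \<open>\<Delta>t\<close>. By the Jury criterion the scheme is therefore stable as
  long as \<open>1 + T + D > 0\<close>, that is \<open>\<alpha> \<Delta>t\<^sup>2 - 2 (\<alpha> + 1) \<Delta>t - 4 < 0\<close>. When the sign is reversed, the
  characteristic polynomial is negative at \<open>-1\<close> and so has a real root below \<open>-1\<close>. The claimed step is
  the positive root of this quadratic.\<close>

text \<open>A non-real root comes with its conjugate, so its squared modulus is \<open>D\<close>.
  For a real root with \<bar>x\<bar> \<ge> 1, the bound on \<open>T\<close> would force the product
  (\<bar>x\<bar> - 1) (\<bar>x\<bar> - D) of nonnegative factors to be negative.\<close>

lemma quadratic_root_norm_less_1:
  fixes T D :: real and z :: complex
  assumes root: "z\<^sup>2 - of_real T * z + of_real D = 0"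
    and "D < 1" and T: "\<bar>T\<bar> < 1 + D"
  shows "cmod z < 1"
proof -
  define x y where "x = Re z" and "y = Im z"
  have z: "z = Complex x y" by (simp add: x_def y_def)
  have re: "x\<^sup>2 - y\<^sup>2 - T * x + D = 0"
    using arg_cong[OF root, of Re] by (simp add: z power2_eq_square)
  have im: "y * (2 * x - T) = 0"
    using arg_cong[OF root, of Im] by (simp add: z power2_eq_square algebra_simps)
  show ?thesis
  proof (cases "y = 0")
    case False
    then have "T = 2 * x" using im by simp
    then have "x\<^sup>2 + y\<^sup>2 < 1" using re \<open>D < 1\<close> by (simp add: power2_eq_square)
    then show ?thesis by (simp add: z cmod_def)
  next
    case True
    have p: "x\<^sup>2 - T * x + D = 0" using re True by simp
    have False if "\<bar>x\<bar> \<ge> 1"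
    proof -
      have "T * x \<le> \<bar>T\<bar> * \<bar>x\<bar>" by (metis abs_ge_self abs_mult)
      also have "\<dots> < (1 + D) * \<bar>x\<bar>" using T that by (intro mult_strict_right_mono) auto
      finally have "\<bar>x\<bar> * \<bar>x\<bar> - (1 + D) * \<bar>x\<bar> + D < 0" using p by (simp add: power2_eq_square)
      moreover have "(\<bar>x\<bar> - 1) * (\<bar>x\<bar> - D) \<ge> 0" using that \<open>D < 1\<close> by simp
      ultimately show False by (simp add: algebra_simps)
    qed
    then show ?thesis using True by (force simp: z cmod_def)
  qed
qed

lemma quadratic_root_less_minus_1:
  fixes T D :: real
  assumes "1 + T + D < 0"
  obtains x where "x\<^sup>2 - T * x + D = 0" "x < -1"
proof
  define s where "s = sqrt (T\<^sup>2 - 4 * D)"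
  \<comment> \<open>The gap between the two sides is -4 (1 + T + D). This one inequality makes the
    discriminant nonnegative and puts the smaller root below -1.\<close>
  have disc: "(T + 2)\<^sup>2 < T\<^sup>2 - 4 * D"
    using assms by (simp add: power2_eq_square algebra_simps)
  have "T\<^sup>2 - 4 * D \<ge> 0" using disc zero_le_power2[of "T + 2"] by linarith
  then have "s\<^sup>2 = T\<^sup>2 - 4 * D" by (simp add: s_def)
  then show "((T - s) / 2)\<^sup>2 - T * ((T - s) / 2) + D = 0"
    by (simp add: power2_eq_square field_simps)
  have "T + 2 < s" unfolding s_def using disc by (rule real_less_rsqrt)
  then show "(T - s) / 2 < -1" by simp
qed

lemma eigenvalue_2x2_iff:
  fixes A :: "'a :: field mat"
  assumes "A \<in> carrier_mat 2 2"
  shows "eigenvalue A k \<longleftrightarrow>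
    k\<^sup>2 - (A $$ (0,0) + A $$ (1,1)) * k + (A $$ (0,0) * A $$ (1,1) - A $$ (0,1) * A $$ (1,0)) = 0"
proof -
  let ?B = "char_matrix A k"
  have B: "?B \<in> carrier_mat 2 2" using assms by simp
  have det: "det ?B = ?B $$ (0,0) * ?B $$ (1,1) - ?B $$ (0,1) * ?B $$ (1,0)"
    using laplace_expansion_row[OF B, of 0] B
    by (simp add: numeral_2_eq_2 cofactor_def det_single mat_delete_def)
  have "det ?B = k\<^sup>2 - (A $$ (0,0) + A $$ (1,1)) * k +
      (A $$ (0,0) * A $$ (1,1) - A $$ (0,1) * A $$ (1,0))"
    unfolding det using assms by (simp add: char_matrix_def power2_eq_square algebra_simps)
  then show ?thesis using eigenvalue_det[OF assms] by simp
qed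

text \<open>The spectral radius is attained at some eigenvalue, so a bound on every root of the
  characteristic polynomial suffices. Trace and determinant enter through equations so that
  simplified closed forms can be supplied for them.\<close>

lemma spectral_radius_2x2_less_1:
  fixes C :: "real mat"
  assumes C: "C \<in> carrier_mat 2 2"
    and T: "T = C $$ (0,0) + C $$ (1,1)"
    and D: "D = C $$ (0,0) * C $$ (1,1) - C $$ (0,1) * C $$ (1,0)"
    and "D < 1" "\<bar>T\<bar> < 1 + D"
  shows "spectral_radius (map_mat complex_of_real C) < 1"
proof -
  let ?C = "map_mat complex_of_real C"
  have C': "?C \<in> carrier_mat 2 2" using C by simp
  obtain k where k: "eigenvalue ?C k" "spectral_radius ?C = cmod k"
    using spectral_radius_mem_max(1)[OF C' pos2] by (auto simp: spectrum_def)
  have "k\<^sup>2 - of_real T * k + of_real D = 0"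
    using k(1) C unfolding eigenvalue_2x2_iff[OF C'] by (simp add: T D)
  then show ?thesis
    unfolding k(2) using assms(4,5) by (rule quadratic_root_norm_less_1)
qed

lemma spectral_radius_2x2_greater_1:
  fixes C :: "real mat"
  assumes C: "C \<in> carrier_mat 2 2"
    and T: "T = C $$ (0,0) + C $$ (1,1)"
    and D: "D = C $$ (0,0) * C $$ (1,1) - C $$ (0,1) * C $$ (1,0)"
    and neg: "1 + T + D < 0"
  shows "spectral_radius (map_mat complex_of_real C) > 1"
proof -
  let ?C = "map_mat complex_of_real C"
  have C': "?C \<in> carrier_mat 2 2" using C by simp
  obtain x where x: "x\<^sup>2 - T * x + D = 0" "x < -1"
    using neg by (rule quadratic_root_less_minus_1)
  from x(1) have "complex_of_real (x\<^sup>2 - T * x + D) = 0" by simp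
  then have "eigenvalue ?C (of_real x)"
    using C unfolding eigenvalue_2x2_iff[OF C'] by (simp add: T D)
  then have "cmod (of_real x) \<le> spectral_radius ?C"
    by (intro spectral_radius_mem_max(2)[OF C' pos2] imageI) (simp add: spectrum_def)
  then show ?thesis using x(2) by simp
qed

text \<open>Stated for every update matrix \<open>C\<close>, since refuting
  \<open>sdc1_stable\<close> means excluding every possible witness; uniqueness reduces this to the
  explicit matrix.\<close>

lemma sdc1_ode_matrix_spectral_radius:
  fixes \<alpha> dt :: real
  assumes "\<alpha> > 0" "dt > 0" "sdc1_update_matrix (ode_matrix \<alpha>) dt C"
  shows "\<alpha> * dt\<^sup>2 - 2 * (\<alpha> + 1) * dt - 4 < 0 \<Longrightarrow> spectral_radius (map_mat complex_of_real C) < 1"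
    and "\<alpha> * dt\<^sup>2 - 2 * (\<alpha> + 1) * dt - 4 > 0 \<Longrightarrow> spectral_radius (map_mat complex_of_real C) > 1"
proof -
  define d where "d = 1 + dt * (\<alpha> + 1)"
  have "dt * (\<alpha> + 1) > 0" using assms by simp
  then have d: "d > 1" by (simp add: d_def)
  have C: "C \<in> carrier_mat 2 2" using assms(3) by (simp add: sdc1_update_matrix_def)
  have C_eq: "C = mat_of_rows_list 2 [[1, dt], [- (\<alpha> * dt / d), (1 - \<alpha> * dt\<^sup>2) / d]]"
    unfolding d_def by (rule sdc1_update_matrix_unique[OF assms(3)
          sdc1_update_matrix_ode_matrix[OF assms(1,2)]])
  have T: "1 + (1 - \<alpha> * dt\<^sup>2) / d = C $$ (0,0) + C $$ (1,1)"
    by (simp add: C_eq mat_of_rows_list_def)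
  \<comment> \<open>The off-diagonal product cancels the \<alpha> dt^2 / d coming from the
    diagonal.\<close>
  have D: "1 / d = C $$ (0,0) * C $$ (1,1) - C $$ (0,1) * C $$ (1,0)"
    by (simp add: C_eq mat_of_rows_list_def power2_eq_square diff_divide_distrib)
  have lower: "1 + (1 + (1 - \<alpha> * dt\<^sup>2) / d) + 1 / d =
      - (\<alpha> * dt\<^sup>2 - 2 * (\<alpha> + 1) * dt - 4) / d"
    \<comment> \<open>Denominators are cleared while \<open>d\<close> is still opaque; only then is
      it expanded.\<close>
    using d by (simp add: field_simps) (simp add: d_def algebra_simps)
  \<comment> \<open>\<open>lower\<close> and \<open>upper\<close> are the values of the
    characteristic polynomial at -1 and 1; both being positive is exactly \<bar>T\<bar> < 1 +
    D.\<close>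
  have upper: "1 - (1 + (1 - \<alpha> * dt\<^sup>2) / d) + 1 / d = \<alpha> * dt\<^sup>2 / d"
    using d by (simp add: field_simps)
  have "\<alpha> * dt\<^sup>2 / d > 0" using assms d by simp
  note upper' = this[folded upper]
  show "spectral_radius (map_mat complex_of_real C) < 1"
    if neg: "\<alpha> * dt\<^sup>2 - 2 * (\<alpha> + 1) * dt - 4 < 0"
  proof (rule spectral_radius_2x2_less_1[OF C T D])
    show "1 / d < 1" using d by simp
    have "- (\<alpha> * dt\<^sup>2 - 2 * (\<alpha> + 1) * dt - 4) / d > 0"
      using neg d by (intro divide_pos_pos) linarith+
    note this[folded lower]
    with upper' show "\<bar>1 + (1 - \<alpha> * dt\<^sup>2) / d\<bar> < 1 + 1 / d" by linarith
  qed
  show "spectral_radius (map_mat complex_of_real C) > 1"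
    if pos: "\<alpha> * dt\<^sup>2 - 2 * (\<alpha> + 1) * dt - 4 > 0"
  proof (rule spectral_radius_2x2_greater_1[OF C T D])
    show "1 + (1 + (1 - \<alpha> * dt\<^sup>2) / d) + 1 / d < 0"
      unfolding lower using pos d by (intro divide_neg_pos) linarith+
  qed
qed

theorem mainTheorem3:
  fixes \<alpha> :: real
  assumes "\<alpha> > 0"
  shows "sdc1_max_stable_step (ode_matrix \<alpha>)
           ((\<alpha> + 1 + sqrt ((\<alpha> + 1)^2 + 4 * \<alpha>)) / \<alpha>)"
proof -
  define s where "s = sqrt ((\<alpha> + 1)\<^sup>2 + 4 * \<alpha>)"
  define r where "r = (\<alpha> + 1 + s) / \<alpha>"
  \<comment> \<open>The other root of the quadratic. It is negative, so for dt > 0 the sign of the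
    quadratic is that of dt - r.\<close>
  define q where "q = (\<alpha> + 1 - s) / \<alpha>"
  have s2: "s\<^sup>2 = (\<alpha> + 1)\<^sup>2 + 4 * \<alpha>" using assms by (simp add: s_def)
  have "\<alpha> + 1 < s" unfolding s_def using assms by (intro real_less_rsqrt) simp
  then have r: "r > 0" and q: "q < 0"
    using assms by (simp_all add: r_def q_def divide_pos_pos divide_neg_pos)
  have factor: "\<alpha> * dt\<^sup>2 - 2 * (\<alpha> + 1) * dt - 4 = \<alpha> * ((dt - r) * (dt - q))" for dt
  proof -
    \<comment> \<open>Vieta: product and sum of the roots are matched with the coefficients.\<close>
    have "\<alpha> * (r * q) = ((\<alpha> + 1)\<^sup>2 - s\<^sup>2) / \<alpha>"
      using assms by (simp add: r_def q_def power2_eq_square field_simps)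
    then have "\<alpha> * (r * q) = -4" using assms by (simp add: s2)
    moreover have "\<alpha> * (r + q) = 2 * (\<alpha> + 1)"
      using assms by (simp add: r_def q_def field_simps)
    moreover have "\<alpha> * ((dt - r) * (dt - q)) = \<alpha> * dt\<^sup>2 - \<alpha> * (r + q) * dt + \<alpha> * (r * q)"
      by (simp add: power2_eq_square algebra_simps)
    ultimately show ?thesis by simp
  qed
  have "sdc1_stable (ode_matrix \<alpha>) dt" if dt: "0 < dt" "dt < r" for dt
  proof -
    have "\<alpha> * ((dt - r) * (dt - q)) < 0"
      using assms dt q by (intro mult_pos_neg mult_neg_pos) linarith+
    then show ?thesis
      unfolding sdc1_stable_def factor[symmetric]
      using sdc1_update_matrix_ode_matrix[OF assms dt(1)]
        sdc1_ode_matrix_spectral_radius(1)[OF assms dt(1)] by blast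
  qed
  moreover have "\<not> sdc1_stable (ode_matrix \<alpha>) dt" if dt: "dt > r" for dt
  proof -
    have "dt > 0" using dt r by linarith
    have "\<alpha> * ((dt - r) * (dt - q)) > 0"
      using assms dt q r by (intro mult_pos_pos) linarith+
    \<comment> \<open>A stabilizing update matrix would have spectral radius both below and above
      1.\<close>
    then show ?thesis
      unfolding sdc1_stable_def factor[symmetric]
      using sdc1_ode_matrix_spectral_radius(2)[OF assms \<open>dt > 0\<close>] by (meson less_asym)
  qed
  ultimately have "sdc1_max_stable_step (ode_matrix \<alpha>) r"
    unfolding sdc1_max_stable_step_def using r by blast
  then show ?thesis by (simp add: r_def s_def)
qed

end
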